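(* Let $a$ be a positive even integer and let $b$ be a prime with $b \equiv 3 \pmod 8$. Then the equation $(a^n-1)(b^n-1)=x^2$ has no solution in positive integers $n, x$. *)

theory Defs
  imports "HOL-Number_Theory.Number_Theory"
begin

end

theory Submission
  imports Defs "HOL-Computational_Algebra.Nth_Powers"
begin

text \<open>
  Modulo 4 the exponent must be even, \<open>n = 2 k\<close>. With \<open>d\<close> the gcd of the two factors,
  \<open>a\<^sup>n - 1 = d y\<^sup>2\<close> and \<open>b\<^sup>n - 1 = d z\<^sup>2\<close>, so \<open>(a\<^sup>k, y)\<close> and \<open>(b\<^sup>k, z)\<close> solve the Pell
  equation \<open>X\<^sup>2 - d Y\<^sup>2 = 1\<close>. Every solution is a square or the fundamental solution times a
  square. In a square the first coordinate is \<open>S\<^sup>2 + d V\<^sup>2 = 2 S\<^sup>2 - 1\<close>, which is odd. Since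
  \<open>a\<^sup>k\<close> is even, the fundamental solution has even first coordinate, so that the odd number \<open>b\<^sup>k\<close>
  must come from a square: \<open>b\<^sup>k = 2 S\<^sup>2 - 1\<close>. Then 2 is a quadratic residue modulo
  \<open>b\<close>, which is impossible for \<open>b\<close> congruent to 3 modulo 8.
\<close>

text \<open>Gauss's lemma: the sign of the Legendre symbol is the parity of the number of residues
  \<open>2 * x\<close>, with \<open>x\<close> from 1 to \<open>(p - 1) / 2\<close>, that exceed
  \<open>(p - 1) / 2\<close>.\<close>

lemma not_QuadRes_2:
  fixes p :: nat
  assumes "prime p" and "p mod 8 = 3"
  shows "\<not> QuadRes (int p) 2"
proof -
  define m where "m = p div 8"
  have p: "p = 8 * m + 3" using assms(2) by (simp add: m_def mult.commute) presburger
  have n0: "[2 \<noteq> 0] (mod int p)"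
    using p by (auto simp: cong_0_iff dest: zdvd_imp_le)
  interpret GAUSS p 2
    using assms(1) p n0 by unfold_locales auto
  have half: "(int p - 1) div 2 = 4 * int m + 1" using p by simp
  \<comment> \<open>The doubles are at most \<open>8 * m + 2\<close>, below \<open>p\<close>, so
    reduction modulo \<open>p\<close> leaves them unchanged.\<close>
  have C: "C = (\<lambda>x. x * 2) ` {0<..4 * int m + 1}"
    unfolding C_def B_def A_def half image_image
    by (rule image_cong) (auto simp: p)
  \<comment> \<open>\<open>2 * x\<close> exceeds \<open>4 * m + 1\<close> exactly from
    \<open>x = 2 * m + 1\<close> on, which leaves \<open>2 * m + 1\<close> values, an odd
    number.\<close>
  have "E = (\<lambda>x. x * 2) ` {2 * int m + 1..4 * int m + 1}"
    unfolding E_def C half by auto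
  then have "card E = card {2 * int m + 1..4 * int m + 1}"
    by (simp add: card_image inj_on_def)
  then have "odd (card E)" by (simp add: nat_add_distrib nat_mult_distrib)
  then have "Legendre 2 (int p) = -1" using gauss_lemma by simp
  then show ?thesis by (auto simp: Legendre_def split: if_splits)
qed

text \<open>Take \<open>d\<close> to be the gcd. The cofactors are coprime with square product, so
  each is a square.\<close>

lemma common_square_class:
  fixes P Q x :: int
  assumes "P > 0" and "Q > 0" and "P * Q = x ^ 2"
  obtains d y z where "d > 0" "y > 0" "z > 0" "P = d * y ^ 2" "Q = d * z ^ 2"
proof -
  define p q where "p = nat P" and "q = nat Q"
  have pos: "p > 0" "q > 0" and PQ: "P = int p" "Q = int q"
    using assms by (auto simp: p_def q_def)
  define g where "g = gcd p q"
  have g: "g > 0" using pos by (simp add: g_def)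
  obtain p' q' where pq: "p = p' * g" "q = q' * g" and cop: "coprime p' q'"
    using gcd_coprime_exists[of p q] pos unfolding g_def by auto
  have "int (p * q) = int (nat \<bar>x\<bar> ^ 2)" using assms(3) PQ by simp
  then have "p * q = nat \<bar>x\<bar> ^ 2" by (simp only: of_nat_eq_iff)
  then have sq: "p' * q' * g ^ 2 = nat \<bar>x\<bar> ^ 2"
    by (simp add: pq power2_eq_square mult_ac)
  then have "g ^ 2 dvd nat \<bar>x\<bar> ^ 2" by (metis dvd_triv_right)
  then have "g dvd nat \<bar>x\<bar>" by simp
  then obtain w where w: "nat \<bar>x\<bar> = g * w" by blast
  have "p' * q' = w ^ 2" using sq g by (simp add: w power_mult_distrib)
  then have "is_nth_power 2 (p' * q')" by (auto simp: is_nth_power_def)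
  then have "is_nth_power 2 p'" "is_nth_power 2 q'"
    using is_nth_power_mult_coprime_nat_iff[OF cop] by auto
  then obtain y z where yz: "p' = y ^ 2" "q' = z ^ 2" by (auto simp: is_nth_power_def)
  show thesis
    by (rule that[of "int g" "int y" "int z"])
       (use pos g in \<open>auto simp: PQ pq yz intro!: Nat.gr0I\<close>)
qed

text \<open>The two expressions are the coordinates of
  \<open>(X + Y * sqrt d) * (T - U * sqrt d)\<close>, the quotient by the solution
  \<open>(T, U)\<close>. The bounds make it a smaller solution, as an induction on \<open>Y\<close>
  needs.\<close>

lemma pell_descent:
  fixes d T U X Y :: int
  assumes "d > 0" "T > 0" "U > 0" "T ^ 2 - d * U ^ 2 = 1"
    and "X > 0" "Y \<ge> U" "X ^ 2 - d * Y ^ 2 = 1"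
  shows "X * T - d * Y * U > 0" "Y * T - X * U \<ge> 0" "Y * T - X * U < Y"
proof -
  have X2: "X ^ 2 = 1 + d * Y ^ 2" and T2: "T ^ 2 = 1 + d * U ^ 2" using assms by auto
  have "(d * Y * U) ^ 2 = (d * Y ^ 2) * (d * U ^ 2)" by (simp add: power2_eq_square)
  also have "\<dots> < X ^ 2 * T ^ 2"
    unfolding X2 T2 using assms by (intro mult_strict_mono) (auto intro: add_pos_nonneg)
  finally have "(d * Y * U) ^ 2 < (X * T) ^ 2" by (simp add: power_mult_distrib)
  then show "X * T - d * Y * U > 0"
    using power_less_imp_less_base[of "d * Y * U" 2 "X * T"] assms by simp
  have "U ^ 2 \<le> Y ^ 2" using assms by (intro power_mono) auto
  then have "(X * U) ^ 2 \<le> (Y * T) ^ 2"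
    unfolding power_mult_distrib X2 T2 by (simp add: algebra_simps)
  then show "Y * T - X * U \<ge> 0"
    using power2_le_imp_le[of "X * U" "Y * T"] assms by simp
  \<comment> \<open>The difference of the two sides is \<open>2 * T - 2\<close>, nonnegative since
    \<open>T\<close> is at least 1.\<close>
  have "(T - 1) ^ 2 \<le> d * U ^ 2" using T2 assms by (simp add: power2_eq_square algebra_simps)
  then have "Y ^ 2 * (T - 1) ^ 2 \<le> Y ^ 2 * (d * U ^ 2)" by (intro mult_left_mono) auto
  also have "\<dots> < X ^ 2 * U ^ 2"
    unfolding X2 using assms by (simp add: algebra_simps)
  finally have "(Y * (T - 1)) ^ 2 < (X * U) ^ 2" by (simp add: power_mult_distrib)
  then have "Y * (T - 1) < X * U"
    using power_less_imp_less_base[of "Y * (T - 1)" 2 "X * U"] assms by simp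
  then show "Y * T - X * U < Y" by (simp add: algebra_simps)
qed

text \<open>\<open>(S ^ 2 + d * V ^ 2, 2 * S * V)\<close> is the square of
  \<open>S + V * sqrt d\<close>; the second alternative multiplies it by
  \<open>T + U * sqrt d\<close>. Dividing by the fundamental solution lowers \<open>Y\<close> and
  swaps the two alternatives.\<close>

lemma pell_square_classes:
  fixes d T U X Y :: int
  assumes fund: "d > 0" "T > 0" "U > 0" "T ^ 2 - d * U ^ 2 = 1"
    and minimal: "\<forall>X>0. \<forall>Y>0. X ^ 2 - d * Y ^ 2 = 1 \<longrightarrow> U \<le> Y"
    and "X > 0" "Y \<ge> 0" "X ^ 2 - d * Y ^ 2 = 1"
  shows "\<exists>S V. S ^ 2 - d * V ^ 2 = 1 \<and>
    (X = S ^ 2 + d * V ^ 2 \<and> Y = 2 * S * V \<or>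
     X = T * (S ^ 2 + d * V ^ 2) + d * U * (2 * S * V) \<and>
     Y = U * (S ^ 2 + d * V ^ 2) + T * (2 * S * V))"
  using assms(6-8)
proof (induction "nat Y" arbitrary: X Y rule: less_induct)
  case less
  show ?case
  proof (cases "Y = 0")
    case True
    then have "X = 1" using less.prems by (simp add: power2_eq_1_iff)
    with True show ?thesis by (intro exI[of _ 1] exI[of _ 0]) simp
  next
    case False
    then have UY: "U \<le> Y" using less.prems minimal by auto
    define X' Y' where "X' = X * T - d * Y * U" and "Y' = Y * T - X * U"
    have desc: "X' > 0" "Y' \<ge> 0" "Y' < Y"
      using pell_descent[OF fund less.prems(1) UY less.prems(3)] by (auto simp: X'_def Y'_def)
    have "X' ^ 2 - d * Y' ^ 2 = (X ^ 2 - d * Y ^ 2) * (T ^ 2 - d * U ^ 2)"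
      unfolding X'_def Y'_def by (simp add: power2_eq_square algebra_simps)
    then have norm': "X' ^ 2 - d * Y' ^ 2 = 1" using less.prems fund by simp
    have "X' * T + d * Y' * U = X * (T ^ 2 - d * U ^ 2)"
      "Y' * T + X' * U = Y * (T ^ 2 - d * U ^ 2)"
      unfolding X'_def Y'_def by (simp_all add: power2_eq_square algebra_simps)
    then have XY: "X = X' * T + d * Y' * U" "Y = Y' * T + X' * U"
      using fund by simp_all
    obtain S V where SV: "S ^ 2 - d * V ^ 2 = 1" and
      alt: "X' = S ^ 2 + d * V ^ 2 \<and> Y' = 2 * S * V \<or>
        X' = T * (S ^ 2 + d * V ^ 2) + d * U * (2 * S * V) \<and>
        Y' = U * (S ^ 2 + d * V ^ 2) + T * (2 * S * V)"
      using less.hyps[of Y' X'] desc norm' by auto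
    from alt show ?thesis
    proof
      assume "X' = S ^ 2 + d * V ^ 2 \<and> Y' = 2 * S * V"
      with SV show ?thesis
        unfolding XY by (intro exI[of _ S] exI[of _ V]) (simp add: algebra_simps)
    next
      assume X'Y': "X' = T * (S ^ 2 + d * V ^ 2) + d * U * (2 * S * V) \<and>
        Y' = U * (S ^ 2 + d * V ^ 2) + T * (2 * S * V)"
      \<comment> \<open>The fundamental solution now occurs twice, so its square is absorbed: the
        new root is \<open>(T + U * sqrt d) * (S + V * sqrt d)\<close>.\<close>
      define S' V' where "S' = T * S + d * U * V" and "V' = U * S + T * V"
      have "S' ^ 2 - d * V' ^ 2 = (T ^ 2 - d * U ^ 2) * (S ^ 2 - d * V ^ 2)"
        unfolding S'_def V'_def by (simp add: power2_eq_square algebra_simps)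
      then have "S' ^ 2 - d * V' ^ 2 = 1" using SV fund by simp
      moreover have "X = S' ^ 2 + d * V' ^ 2" "Y = 2 * S' * V'"
        unfolding XY S'_def V'_def using X'Y' by (simp_all add: power2_eq_square algebra_simps)
      ultimately show ?thesis by blast
    qed
  qed
qed

lemma pell_odd_if_even_solution:
  fixes d A B y z :: int
  assumes "d > 0" "A > 0" "y > 0" "A ^ 2 - d * y ^ 2 = 1" "even A"
    and "B > 0" "z > 0" "B ^ 2 - d * z ^ 2 = 1" "odd B"
  obtains S where "B = 2 * S ^ 2 - 1"
proof -
  \<comment> \<open>Ranging over naturals gives a least second coordinate, hence a fundamental
    solution.\<close>
  define sol where "sol u \<longleftrightarrow> u > 0 \<and> (\<exists>t>0. t ^ 2 - d * int u ^ 2 = 1)" for u :: nat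
  define U where "U = int (LEAST u. sol u)"
  have "sol (nat y)" using assms by (auto simp: sol_def)
  then have "sol (LEAST u. sol u)" by (rule LeastI)
  then obtain T where fund: "T > 0" "U > 0" "T ^ 2 - d * U ^ 2 = 1"
    by (auto simp: sol_def U_def)
  have minimal: "\<forall>X>0. \<forall>Y>0. X ^ 2 - d * Y ^ 2 = 1 \<longrightarrow> U \<le> Y"
  proof (intro allI impI)
    fix X Y :: int
    assume XY: "X > 0" "Y > 0" "X ^ 2 - d * Y ^ 2 = 1"
    then have "sol (nat Y)" by (auto simp: sol_def)
    then have "(LEAST u. sol u) \<le> nat Y" by (rule Least_le)
    then show "U \<le> Y" using XY by (simp add: U_def)
  qed
  note classes = pell_square_classes[OF \<open>d > 0\<close> fund minimal]
  have parity: "odd (S ^ 2 + d * V ^ 2)" if "S ^ 2 - d * V ^ 2 = 1" for S V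
  proof -
    have "S ^ 2 + d * V ^ 2 = 2 * (d * V ^ 2) + 1" using that by simp
    then show ?thesis by simp
  qed
  obtain S V where SV: "S ^ 2 - d * V ^ 2 = 1"
    and "A = S ^ 2 + d * V ^ 2 \<or> A = T * (S ^ 2 + d * V ^ 2) + d * U * (2 * S * V)"
    using classes[of A y] assms by auto
  \<comment> \<open>The first alternative would make \<open>A\<close> odd; in the second,
    \<open>A\<close> has the parity of \<open>T\<close>.\<close>
  then have "even T" using parity[OF SV] \<open>even A\<close> by auto
  obtain S V where SV: "S ^ 2 - d * V ^ 2 = 1"
    and "B = S ^ 2 + d * V ^ 2 \<or> B = T * (S ^ 2 + d * V ^ 2) + d * U * (2 * S * V)"
    using classes[of B z] assms by auto
  then have "B = S ^ 2 + d * V ^ 2" using \<open>even T\<close> \<open>odd B\<close> by auto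
  with SV show thesis by (intro that[of S]) simp
qed

theorem theorem2:
  fixes a b :: int
  assumes "a > 0" and "even a"
    and "prime b" and "[b = 3] (mod 8)"
  shows "\<not> (\<exists>(n::nat) (x::int). n > 0 \<and> x > 0 \<and> (a ^ n - 1) * (b ^ n - 1) = x ^ 2)"
proof
  assume "\<exists>(n::nat) (x::int). n > 0 \<and> x > 0 \<and> (a ^ n - 1) * (b ^ n - 1) = x ^ 2"
  then obtain n :: nat and x :: int where n: "n > 0"
    and eq: "(a ^ n - 1) * (b ^ n - 1) = x ^ 2" by blast
  have a: "a > 1" using assms(1,2) by (cases "a = 1") auto
  have b: "b > 1" using assms(3) by (simp add: prime_gt_1_int)
  have b8: "b mod 8 = 3" using assms(4) by (simp add: cong_def)
  then have b4: "b mod 4 = 3" and oddb: "odd b" by presburger+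
  have odda: "odd (a ^ n - 1)" using n assms(2) by simp
  have "even n"
  \<comment> \<open>For odd \<open>n\<close>, \<open>b ^ n - 1\<close> is 2 modulo 4 and
    \<open>a ^ n - 1\<close> is odd, so the product is even but not divisible by 4.\<close>
  proof (rule ccontr)
    assume "odd n"
    have "[b = -1] (mod 4)" using b4 by (simp add: cong_def)
    then have "[b ^ n = (-1) ^ n] (mod 4)" by (rule cong_pow)
    then have bn: "b ^ n mod 4 = 3" using \<open>odd n\<close> by (simp add: cong_def)
    then have "even (b ^ n - 1)" by presburger
    then have "even (x ^ 2)" using eq by (metis even_mult_iff)
    then have "2 ^ 2 dvd x ^ 2" by (intro dvd_power_same) simp
    then have "4 dvd (a ^ n - 1) * (b ^ n - 1)" by (simp add: eq)
    moreover have "coprime 4 (a ^ n - 1)"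
      using odda coprime_power_left_iff[of 2 2 "a ^ n - 1"] by simp
    ultimately have "4 dvd b ^ n - 1" using coprime_dvd_mult_right_iff by blast
    with bn show False by presburger
  qed
  then obtain k where k: "n = k * 2" by (metis dvd_def mult.commute)
  have kpos: "k > 0" using n k by simp
  have pos: "a ^ n - 1 > 0" "b ^ n - 1 > 0" using a b n by simp_all
  obtain d y z where dyz: "d > 0" "y > 0" "z > 0"
    and P: "a ^ n - 1 = d * y ^ 2" and Q: "b ^ n - 1 = d * z ^ 2"
    using common_square_class[OF pos eq] .
  obtain S where S: "b ^ k = 2 * S ^ 2 - 1"
  proof (rule pell_odd_if_even_solution)
    show "(a ^ k) ^ 2 - d * y ^ 2 = 1" "(b ^ k) ^ 2 - d * z ^ 2 = 1"
      using P Q by (simp_all add: k power_mult)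
  qed (use dyz a b kpos assms(2) oddb in auto)
  \<comment> \<open>Doubling \<open>b ^ k = 2 * S ^ 2 - 1\<close> exhibits \<open>2 * S\<close> as a
    square root of 2 modulo \<open>b\<close>.\<close>
  have "b dvd 2 * b ^ k" using kpos by (simp add: dvd_power)
  also have "2 * b ^ k = (2 * S) ^ 2 - 2" unfolding S by (simp add: power2_eq_square)
  finally have "QuadRes b 2" unfolding QuadRes_def cong_iff_dvd_diff by blast
  moreover have "nat b mod 8 = 3" using b b8 nat_mod_distrib[of b 8] by simp
  then have "\<not> QuadRes (int (nat b)) 2"
    using assms(3) b by (intro not_QuadRes_2) auto
  ultimately show False using b by simp
qed

end
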